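(* Let $M\ge1$, $B_c>0$, $P_T>0$, let $q_1,\dots,q_M\ge0$ be given, and fix $m\in\{1,\dots,M\}$ with $W_{1,m},W_{2,m}>0$, $\Gamma_{1,m},\Gamma_{2,m}>0$. Suppose that $\Gamma_{1,m}\ge\Gamma_{2,m}$, $1<W_{2,m}/W_{1,m}<\Gamma_{1,m}/\Gamma_{2,m}$ and $q_m>2\Omega_m$, with $$\Omega_m=\frac{W_{2,m}\Gamma_{2,m}-W_{1,m}\Gamma_{1,m}}{\Gamma_{1,m}\Gamma_{2,m}(W_{1,m}-W_{2,m})}.$$ Then the optimal solution of $$\max_{p_{1,m},p_{2,m}}\ \frac{W_{1,m}R_{1,m}+W_{2,m}R_{2,m}}{P_T+\sum_{k=1}^Mq_k}\quad\text{s.t.}\quad 0\le p_{1,m}\le p_{2,m},\ \ p_{1,m}+p_{2,m}=q_m,$$ where $R_{1,m}=B_c\log(1+p_{1,m}\Gamma_{1,m})$ and $R_{2,m}=B_c\log\left(1+\frac{p_{2,m}\Gamma_{2,m}}{p_{1,m}\Gamma_{2,m}+1}\right)$, is the same as that of the problem of maximizing $W_{1,m}R_{1,m}+W_{2,m}R_{2,m}$ under the same constraints, namely $p_{1,m}^\star=\Omega_m$ and $p_{2,m}^\star=q_m-p_{1,m}^\star$.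
   Context: Setting: downlink NOMA with $M$ channels of bandwidth $B_c$, two users per channel; $\Gamma_{l,m}$ is the channel-to-noise ratio of user $l$ on channel $m$, $p_{l,m}$ its power, $R_{l,m}$ its rate, $W_{l,m}$ its weight, $q_m$ the power budget of channel $m$, $P_T$ the circuit power consumption. $\log$ is the base-2 logarithm. *)

theory Defs
  imports Complex_Main
begin

text \<open>
  Two-user downlink NOMA. Families \<open>X l m\<close> are indexed by the user \<open>l \<in> {1, 2}\<close> and the channel
  \<open>m \<in> {1..M}\<close>. A power allocation on one channel is a pair (power of user 1, power of user 2).
  Only the signal of user 1 interferes at user 2: user 1 cancels the signal of user 2.
\<close>

definition rate1 :: "real \<Rightarrow> (nat \<Rightarrow> nat \<Rightarrow> real) \<Rightarrow> nat \<Rightarrow> real \<times> real \<Rightarrow> real" where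
  "rate1 B \<Gamma> m = (\<lambda>(p1, p2). B * log 2 (1 + p1 * \<Gamma> 1 m))"

definition rate2 :: "real \<Rightarrow> (nat \<Rightarrow> nat \<Rightarrow> real) \<Rightarrow> nat \<Rightarrow> real \<times> real \<Rightarrow> real" where
  "rate2 B \<Gamma> m = (\<lambda>(p1, p2). B * log 2 (1 + p2 * \<Gamma> 2 m / (p1 * \<Gamma> 2 m + 1)))"

definition weighted_sum_rate ::
  "real \<Rightarrow> (nat \<Rightarrow> nat \<Rightarrow> real) \<Rightarrow> (nat \<Rightarrow> nat \<Rightarrow> real) \<Rightarrow> nat \<Rightarrow> real \<times> real \<Rightarrow> real" where
  "weighted_sum_rate B W \<Gamma> m p = W 1 m * rate1 B \<Gamma> m p + W 2 m * rate2 B \<Gamma> m p"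

definition energy_efficiency ::
  "nat \<Rightarrow> real \<Rightarrow> real \<Rightarrow> (nat \<Rightarrow> real) \<Rightarrow> (nat \<Rightarrow> nat \<Rightarrow> real) \<Rightarrow> (nat \<Rightarrow> nat \<Rightarrow> real) \<Rightarrow> nat
    \<Rightarrow> real \<times> real \<Rightarrow> real" where
  "energy_efficiency M B P\<^sub>T q W \<Gamma> m p = weighted_sum_rate B W \<Gamma> m p / (P\<^sub>T + (\<Sum>k = 1..M. q k))"

definition feasible :: "real \<Rightarrow> real \<times> real \<Rightarrow> bool" where
  "feasible Q = (\<lambda>(p1, p2). 0 \<le> p1 \<and> p1 \<le> p2 \<and> p1 + p2 = Q)"

definition Omega :: "(nat \<Rightarrow> nat \<Rightarrow> real) \<Rightarrow> (nat \<Rightarrow> nat \<Rightarrow> real) \<Rightarrow> nat \<Rightarrow> real" where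
  "Omega W \<Gamma> m = (W 2 m * \<Gamma> 2 m - W 1 m * \<Gamma> 1 m) / (\<Gamma> 1 m * \<Gamma> 2 m * (W 1 m - W 2 m))"

text \<open>The set of all maximizers, so that uniqueness can be stated by equality with a singleton.\<close>

definition optimal_solutions :: "('a \<Rightarrow> real) \<Rightarrow> ('a \<Rightarrow> bool) \<Rightarrow> 'a set" where
  "optimal_solutions f P = {x. is_arg_max f P x}"

end

(* On the feasible segment p2 = Q - p1 the weighted sum rate is, up to a constant and the factor
   B / ln 2, equal to W1 ln (1 + p1 G1) - W2 ln (1 + p1 G2). Put r = W2 / W1 and
   y = G2 (p1 - Omega) / (1 + Omega G2). The stationarity equation at Omega says
   (1 + p1 G1) / (1 + Omega G1) = 1 + r y, so optimality of Omega is exactly Bernoulli's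
   inequality ln (1 + r y) < r ln (1 + y), strict for y \<noteq> 0. *)
theory Submission
  imports Defs
begin

text \<open>With \<open>s = 1 + y\<close>, the difference of the two sides is
  \<open>ln ((1 + r * y) / s) + (r - 1) * ln (1 / s)\<close>. Bounding both logarithms by
  \<open>ln t \<le> t - 1\<close> suffices; the second bound is strict because
  \<open>s \<noteq> 1\<close>.\<close>

lemma ln_strict_Bernoulli:
  fixes r y :: real
  assumes "r > 1" "y \<noteq> 0" "1 + y > 0" "1 + r * y > 0"
  shows "ln (1 + r * y) < r * ln (1 + y)"
proof -
  define s where "s = 1 + y"
  have s: "s > 0" "s \<noteq> 1"
    using assms by (auto simp: s_def)
  have "ln (1 / s) \<noteq> 1 / s - 1"
    using ln_eq_minus_one[of "1 / s"] s by auto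
  moreover have "ln (1 / s) \<le> 1 / s - 1"
    using s by (intro ln_le_minus_one) simp
  ultimately have "(r - 1) * ln (1 / s) < (r - 1) * (1 / s - 1)"
    using assms(1) by simp
  moreover have "ln ((1 + r * y) / s) \<le> (1 + r * y) / s - 1"
    using s assms by (intro ln_le_minus_one) simp
  \<comment> \<open>The two tangent-line bounds are \<open>(r - 1) * y / s\<close> and its negative,
    so they cancel exactly.\<close>
  moreover have "(1 + r * y) / s - 1 + (r - 1) * (1 / s - 1) = 0"
    using s by (simp add: field_simps) (simp add: s_def algebra_simps)
  ultimately have "ln ((1 + r * y) / s) + (r - 1) * ln (1 / s) < 0"
    by linarith
  then show ?thesis
    using s assms by (simp add: ln_div algebra_simps flip: s_def)
qed

text \<open>\<open>stationary\<close> says that the derivative of the difference vanishes at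
  \<open>x0\<close>, cleared of denominators. Bernoulli's inequality makes this critical point a
  strict global maximum on the half-line, without any concavity argument.\<close>

lemma weighted_ln_diff_less:
  fixes w1 w2 g1 g2 x x0 :: real
  assumes "0 < w1" "w1 < w2" "0 < g1" "0 < g2" "0 \<le> x" "0 \<le> x0" "x \<noteq> x0"
    and stationary: "w1 * g1 * (1 + x0 * g2) = w2 * g2 * (1 + x0 * g1)"
  shows "w1 * ln (1 + x * g1) - w2 * ln (1 + x * g2)
       < w1 * ln (1 + x0 * g1) - w2 * ln (1 + x0 * g2)"
proof -
  define r where "r = w2 / w1"
  define y where "y = g2 * (x - x0) / (1 + x0 * g2)"
  have pos: "1 + x * g1 > 0" "1 + x * g2 > 0" "1 + x0 * g1 > 0" "1 + x0 * g2 > 0"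
    using assms by (simp_all add: add_pos_nonneg)
  have y: "1 + y = (1 + x * g2) / (1 + x0 * g2)"
    using pos by (simp add: y_def field_simps)
  \<comment> \<open>Here \<open>stationary\<close> enters: \<open>y\<close> is the relative change
    of \<open>1 + x * g2\<close> from \<open>x0\<close>, and this identity makes
    \<open>r * y\<close> that of \<open>1 + x * g1\<close>.\<close>
  have slope: "r * (g2 / (1 + x0 * g2)) = g1 / (1 + x0 * g1)"
  proof -
    have "w2 * g2 / (w1 * (1 + x0 * g2)) = g1 / (1 + x0 * g1)"
      using pos assms(1) stationary by (subst frac_eq_eq) (simp_all add: ac_simps)
    then show ?thesis
      by (simp add: r_def)
  qed
  have "r * y = r * (g2 / (1 + x0 * g2)) * (x - x0)"
    by (simp add: y_def)
  also have "\<dots> = g1 / (1 + x0 * g1) * (x - x0)"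
    unfolding slope ..
  finally have ry: "1 + r * y = (1 + x * g1) / (1 + x0 * g1)"
    using pos by (simp add: field_simps)
  have "ln (1 + r * y) < r * ln (1 + y)"
  proof (rule ln_strict_Bernoulli)
    show "r > 1" using assms by (simp add: r_def)
    show "y \<noteq> 0" using assms pos by (simp add: y_def)
    show "1 + y > 0" unfolding y using pos by simp
    show "1 + r * y > 0" unfolding ry using pos by simp
  qed
  then have "w1 * ln (1 + r * y) < w1 * (r * ln (1 + y))"
    using assms(1) by simp
  also have "\<dots> = w2 * ln (1 + y)"
    using assms(1) by (simp add: r_def)
  finally show ?thesis
    unfolding y ry using pos by (simp add: ln_div algebra_simps)
qed

text \<open>Since \<open>p1 + p2 = Q\<close>, signal plus interference at user 2 is fixed, so the
  rate of user 2 splits into a constant minus a logarithm in \<open>p1\<close>.\<close>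

lemma weighted_sum_rate_feasible:
  assumes "feasible Q (p1, p2)" "\<Gamma> 2 m > 0"
  shows "weighted_sum_rate B W \<Gamma> m (p1, p2)
       = B / ln 2 * (W 2 m * ln (1 + Q * \<Gamma> 2 m)
           + (W 1 m * ln (1 + p1 * \<Gamma> 1 m) - W 2 m * ln (1 + p1 * \<Gamma> 2 m)))"
proof -
  have p: "0 \<le> p1" "0 \<le> Q" "p2 = Q - p1"
    using assms(1) by (auto simp: feasible_def)
  have pos: "1 + p1 * \<Gamma> 2 m > 0" "1 + Q * \<Gamma> 2 m > 0"
    using p assms(2) by (simp_all add: add_pos_nonneg)
  have "1 + p2 * \<Gamma> 2 m / (p1 * \<Gamma> 2 m + 1) = (1 + Q * \<Gamma> 2 m) / (1 + p1 * \<Gamma> 2 m)"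
    unfolding p(3) using pos by (simp add: field_simps)
  then show ?thesis
    using pos by (simp add: weighted_sum_rate_def rate1_def rate2_def log_def ln_div field_simps)
qed

text \<open>The products of all three factors collect, so the equation is linear in
  \<open>Omega\<close> and the definition is its solution.\<close>

lemma Omega_stationary:
  assumes "\<Gamma> 1 m > 0" "\<Gamma> 2 m > 0" "W 1 m \<noteq> W 2 m"
  shows "W 1 m * \<Gamma> 1 m * (1 + Omega W \<Gamma> m * \<Gamma> 2 m)
       = W 2 m * \<Gamma> 2 m * (1 + Omega W \<Gamma> m * \<Gamma> 1 m)"
proof -
  have "\<Gamma> 1 m * \<Gamma> 2 m * (W 1 m - W 2 m) \<noteq> 0"
    using assms by simp
  then have "Omega W \<Gamma> m * (\<Gamma> 1 m * \<Gamma> 2 m * (W 1 m - W 2 m)) = W 2 m * \<Gamma> 2 m - W 1 m * \<Gamma> 1 m"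
    by (simp add: Omega_def)
  then show ?thesis
    by (simp add: algebra_simps)
qed

lemma Omega_pos:
  assumes "\<Gamma> 1 m > 0" "\<Gamma> 2 m > 0" "W 1 m < W 2 m" "W 2 m * \<Gamma> 2 m < W 1 m * \<Gamma> 1 m"
  shows "Omega W \<Gamma> m > 0"
  unfolding Omega_def using assms by (intro divide_neg_neg mult_pos_neg) auto

lemma optimal_solutions_eq_singleton:
  assumes "P x" "\<And>y. P y \<Longrightarrow> y \<noteq> x \<Longrightarrow> f y < f x"
  shows "optimal_solutions f P = {x}"
proof -
  have "is_arg_max f P y \<longleftrightarrow> y = x" for y
    using assms unfolding is_arg_max_def by (metis less_asym)
  then show ?thesis
    by (simp add: optimal_solutions_def)
qed

lemma optimal_solutions_divide:
  assumes "c > 0"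
  shows "optimal_solutions (\<lambda>x. f x / c) P = optimal_solutions f P"
  using assms by (simp add: optimal_solutions_def is_arg_max_def divide_less_cancel)

theorem proposition4:
  fixes M m :: nat and B\<^sub>c P\<^sub>T :: real and q :: "nat \<Rightarrow> real"
    and W \<Gamma> :: "nat \<Rightarrow> nat \<Rightarrow> real"
  assumes "M \<ge> 1" and "B\<^sub>c > 0" and "P\<^sub>T > 0"
    and "\<And>k. k \<in> {1..M} \<Longrightarrow> q k \<ge> 0"
    and "m \<in> {1..M}"
    and "W 1 m > 0" and "W 2 m > 0"
    and "\<Gamma> 1 m > 0" and "\<Gamma> 2 m > 0"
    and "\<Gamma> 1 m \<ge> \<Gamma> 2 m"
    and "1 < W 2 m / W 1 m" and "W 2 m / W 1 m < \<Gamma> 1 m / \<Gamma> 2 m"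
    and "q m > 2 * Omega W \<Gamma> m"
  shows "optimal_solutions (energy_efficiency M B\<^sub>c P\<^sub>T q W \<Gamma> m) (feasible (q m))
           = optimal_solutions (weighted_sum_rate B\<^sub>c W \<Gamma> m) (feasible (q m))
       \<and> optimal_solutions (weighted_sum_rate B\<^sub>c W \<Gamma> m) (feasible (q m))
           = {(Omega W \<Gamma> m, q m - Omega W \<Gamma> m)}"
proof
  \<comment> \<open>The denominator involves only the given budgets, so it is a positive constant
    over the feasible set.\<close>
  have "P\<^sub>T + (\<Sum>k = 1..M. q k) > 0"
    using assms(3,4) by (intro add_pos_nonneg sum_nonneg)
  then show "optimal_solutions (energy_efficiency M B\<^sub>c P\<^sub>T q W \<Gamma> m) (feasible (q m))
           = optimal_solutions (weighted_sum_rate B\<^sub>c W \<Gamma> m) (feasible (q m))"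
    unfolding energy_efficiency_def by (rule optimal_solutions_divide)
next
  let ?x = "Omega W \<Gamma> m"
  have W: "W 1 m < W 2 m" and "W 2 m * \<Gamma> 2 m < W 1 m * \<Gamma> 1 m"
    using assms(6-12) by (simp_all add: field_simps)
  then have x: "?x > 0"
    using assms(8,9) by (intro Omega_pos)
  show "optimal_solutions (weighted_sum_rate B\<^sub>c W \<Gamma> m) (feasible (q m)) = {(?x, q m - ?x)}"
  proof (rule optimal_solutions_eq_singleton)
    \<comment> \<open>The bound \<open>q m > 2 * Omega W \<Gamma> m\<close> yields the ordering of
      the two powers.\<close>
    show opt: "feasible (q m) (?x, q m - ?x)"
      using x assms(13) by (simp add: feasible_def)
    fix p assume p: "feasible (q m) p" "p \<noteq> (?x, q m - ?x)"
    obtain p1 p2 where [simp]: "p = (p1, p2)"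
      by (cases p)
    \<comment> \<open>The budget determines \<open>p2\<close> from \<open>p1\<close>, so distinct
      feasible pairs already differ in \<open>p1\<close>.\<close>
    have "0 \<le> p1" "p1 \<noteq> ?x"
      using p by (auto simp: feasible_def)
    then have "W 1 m * ln (1 + p1 * \<Gamma> 1 m) - W 2 m * ln (1 + p1 * \<Gamma> 2 m)
             < W 1 m * ln (1 + ?x * \<Gamma> 1 m) - W 2 m * ln (1 + ?x * \<Gamma> 2 m)"
      using W x assms(6,8,9) Omega_stationary[of \<Gamma> m W] by (intro weighted_ln_diff_less) auto
    then show "weighted_sum_rate B\<^sub>c W \<Gamma> m p < weighted_sum_rate B\<^sub>c W \<Gamma> m (?x, q m - ?x)"
      using p(1) opt assms(2,9) by (simp add: weighted_sum_rate_feasible divide_strict_right_mono)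
  qed
qed

end
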